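(* Let $(X,\mathcal{F}(<),\mu,T)$ be a nigh aperiodic shuffleable system. Then for every integer $n\ge 1$ and every $\varepsilon>0$ there exists a set $E\in\mathcal{F}(<)$ inducing an $n$-chain such that $$\mu\left(\bigcup_{j=0}^{n-1}T^{-j}E\right)>1-\varepsilon.$$
   Context: Let $X$ be a set with a total order $<$. An interval in $X$ is any set $J\subseteq X$ such that if $a,c\in J$ and $a<b<c$ with $b\in X$, then $b\in J$. $\mathcal{F}(<)$ denotes the $\sigma$-algebra on $X$ generated by all intervals. A shuffleable system is a probability measure-preserving dynamical system $(X,\mathcal{F}(<),\mu,T)$: $\mu$ is a probability measure on $\mathcal{F}(<)$, $T:X\to X$ is $\mathcal{F}(<)$-measurable (not necessarily invertible) with $\mu(T^{-1}A)=\mu(A)$ for all $A\in\mathcal{F}(<)$, and $\mu$ is non-atomic (it has no atoms, i.e. every measurable set of positive measure contains a measurable subset of strictly smaller positive measure). For $a,b\in X$, $\langle a,b\rangle=\{x\in X:\min(a,b)\le x\le\max(a,b)\}$ is the closed interval between $a$ and $b$ (equal to $\{a\}$ if $a=b$). $T$ (or the system) is nigh aperiodic if $\mu\{x\in X:\mu\langle x,T^n x\rangle=0\}=0$ for every integer $n\ge1$. A set $E\in\mathcal{F}(<)$ induces an $n$-chain if $\mu(E)>0$ and $\mu(T^{-m}E\cap E)=0$ for all $m=1,\dots,n-1$. *)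

theory Defs
  imports "HOL-Probability.Probability"
begin

(* The totally ordered set is an arbitrary subset X of a linearly ordered type, with the
   induced order; intervals are relative to X. *)

definition order_interval :: "'a::linorder set \<Rightarrow> 'a set \<Rightarrow> bool" where
  "order_interval X J \<longleftrightarrow>
     J \<subseteq> X \<and> (\<forall>a\<in>J. \<forall>c\<in>J. \<forall>b\<in>X. a < b \<and> b < c \<longrightarrow> b \<in> J)"

definition interval_algebra :: "'a::linorder set \<Rightarrow> 'a set set" where
  "interval_algebra X = sigma_sets X {J. order_interval X J}"

definition closed_between :: "'a::linorder set \<Rightarrow> 'a \<Rightarrow> 'a \<Rightarrow> 'a set" where
  "closed_between X a b = {x \<in> X. min a b \<le> x \<and> x \<le> max a b}"

definition non_atomic :: "'a measure \<Rightarrow> bool" where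
  "non_atomic M \<longleftrightarrow>
     (\<forall>A\<in>sets M. measure M A > 0 \<longrightarrow>
        (\<exists>B\<in>sets M. B \<subseteq> A \<and> 0 < measure M B \<and> measure M B < measure M A))"

locale shuffleable_system = prob_space M
  for X :: "'a::linorder set" and M :: "'a measure" and T :: "'a \<Rightarrow> 'a" +
  assumes space_eq: "space M = X"
    and sets_eq: "sets M = interval_algebra X"
    and measurable_T: "T \<in> measurable M M"
    and measure_preserving:
      "\<And>A. A \<in> sets M \<Longrightarrow> measure M (T -` A \<inter> space M) = measure M A"
    and non_atomic: "non_atomic M"

(* Membership in null_sets asserts measurability as well as measure 0; the function measure
   alone would return 0 on any non-measurable set. In a shuffleable system the set below is
   always measurable: with F x = measure M {y \<in> X. y \<le> x}, which is monotone, it is the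
   set where F and F o T^n agree. *)

definition nigh_aperiodic :: "'a::linorder measure \<Rightarrow> ('a \<Rightarrow> 'a) \<Rightarrow> bool" where
  "nigh_aperiodic M T \<longleftrightarrow>
     (\<forall>n::nat. n \<ge> 1 \<longrightarrow>
        {x \<in> space M. measure M (closed_between (space M) x ((T ^^ n) x)) = 0} \<in> null_sets M)"

definition induces_chain :: "'a measure \<Rightarrow> ('a \<Rightarrow> 'a) \<Rightarrow> nat \<Rightarrow> 'a set \<Rightarrow> bool" where
  "induces_chain M T n E \<longleftrightarrow>
     E \<in> sets M \<and> measure M E > 0 \<and>
     (\<forall>m\<in>{1..<n}. measure M (((T ^^ m) -` E \<inter> space M) \<inter> E) = 0)"

end

theory Submission
  imports Defs
begin

text \<open>Let \<open>F x\<close> be the measure of the initial segment below \<open>x\<close>; since points are null,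
  nigh aperiodicity says that \<open>F (T\<^sup>m x) \<noteq> F x\<close> for almost every \<open>x\<close>. The set of \<open>\<eta>\<close>-minimal points
  \<open>A = {x. \<forall>i. F x < F (T\<^sup>i x) + \<eta>}\<close> meets every orbit: a point of the orbit at which \<open>F\<close> is within \<open>\<eta>\<close>
  of its infimum lies in \<open>A\<close>. As \<open>\<eta> \<rightarrow> 0\<close> the sets \<open>A\<close> decrease to the set \<open>D\<close> of points minimising \<open>F\<close>
  on their forward orbit. If \<open>x\<close> and \<open>T\<^sup>m x\<close> both lie in \<open>D\<close>, then almost surely
  \<open>F x < q < F (T\<^sup>m x)\<close> for a rational \<open>q\<close>, and from time \<open>m\<close> on the orbit stays above \<open>q\<close>, which
  contradicts recurrence; hence \<open>D\<close> is almost disjoint from its preimages and therefore null.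
  So \<open>A\<close> can be taken of measure less than \<open>\<epsilon> / n\<close>. With \<open>r x\<close> the first hitting time of \<open>A\<close>, the set
  \<open>E = {x. r x mod n = n - 1}\<close> is the base of the required tower: it misses only points
  with \<open>r x < n - 1\<close>.\<close>

section \<open>Recurrence, towers and sweeping sets in a measure-preserving system\<close>

locale measure_preserving_system = prob_space M
  for M :: "'a measure" and T :: "'a \<Rightarrow> 'a" +
  assumes measurable_map: "T \<in> measurable M M"
    and measure_vimage:
      "\<And>A. A \<in> sets M \<Longrightarrow> measure M (T -` A \<inter> space M) = measure M A"
begin

lemma measurable_funpow [measurable]: "(T ^^ m) \<in> measurable M M"
  by (rule measurable_compose_n[OF measurable_map])

lemma funpow_in_space: "x \<in> space M \<Longrightarrow> (T ^^ m) x \<in> space M"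
  using measurable_funpow by (rule measurable_space)

lemma measure_vimage_funpow:
  assumes "A \<in> sets M"
  shows "measure M ((T ^^ m) -` A \<inter> space M) = measure M A"
proof (induction m)
  case 0
  show ?case using sets.sets_into_space[OF assms] by (simp add: Int_absorb2)
next
  case (Suc m)
  have "(T ^^ Suc m) -` A \<inter> space M = T -` ((T ^^ m) -` A \<inter> space M) \<inter> space M"
    using measurable_space[OF measurable_map] by (auto simp: funpow_swap1)
  then show ?case
    using Suc measure_vimage[OF measurable_sets[OF measurable_funpow assms]] by metis
qed

text \<open>Poincare recurrence with a delay: the preimages of \<open>V\<close> at times that are
  multiples of \<open>Suc m\<close> are pairwise disjoint and equally large, which finite total mass
  allows only for a null set.\<close>

lemma eventually_wandering_null:
  assumes V: "V \<in> sets M"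
    and wandering: "\<And>x j. x \<in> V \<Longrightarrow> m \<le> j \<Longrightarrow> (T ^^ j) x \<notin> V"
  shows "V \<in> null_sets M"
proof -
  define B where "B k = (T ^^ (Suc m * k)) -` V \<inter> space M" for k
  have B: "B k \<in> sets M" for k
    unfolding B_def using V by measurable
  have disj: "B k \<inter> B l = {}" if "k < l" for k l
  proof -
    obtain d where d: "l = k + Suc d" using less_imp_Suc_add[OF \<open>k < l\<close>] by auto
    have "(T ^^ (Suc m * l)) x \<notin> V" if "(T ^^ (Suc m * k)) x \<in> V" for x
    proof -
      have "Suc m * l = Suc m * Suc d + Suc m * k" by (simp add: d algebra_simps)
      then have "(T ^^ (Suc m * l)) x = (T ^^ (Suc m * Suc d)) ((T ^^ (Suc m * k)) x)"
        by (simp only: funpow_add o_apply)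
      moreover have "m \<le> Suc m * Suc d" by simp
      ultimately show ?thesis using wandering[OF that] by metis
    qed
    then show ?thesis unfolding B_def by blast
  qed
  have "disjoint_family B"
    unfolding disjoint_family_on_def using disj by (metis Int_commute linorder_neqE_nat)
  then have "(\<lambda>k. measure M (B k)) sums measure M (\<Union>k. B k)"
    using B by (intro finite_measure_UNION) auto
  then have "summable (\<lambda>k::nat. measure M V)"
    unfolding B_def measure_vimage_funpow[OF V] by (rule sums_summable)
  then have "measure M V = 0"
    using summable_LIMSEQ_zero LIMSEQ_const_iff by blast
  then show ?thesis using V by (simp add: emeasure_eq_measure null_setsI)
qed

lemma tower_over_sweeping_set:
  assumes A: "A \<in> sets M"
    and sweeping: "\<And>x. x \<in> space M \<Longrightarrow> \<exists>j. (T ^^ j) x \<in> A"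
    and n: "n \<ge> 1"
  obtains E where "E \<in> sets M"
    and "\<And>m. m \<in> {1..<n} \<Longrightarrow> ((T ^^ m) -` E \<inter> space M) \<inter> E = {}"
    and "measure M (\<Union>j<n. (T ^^ j) -` E \<inter> space M) \<ge> 1 - real n * measure M A"
proof
  define r where "r x = (LEAST j. (T ^^ j) x \<in> A)" for x
  \<comment> \<open>With residue \<open>n - 1\<close> rather than 0, a point of \<open>E\<close>
    cannot enter \<open>A\<close> before time \<open>n - 1\<close>, so \<open>r\<close> drops by
    exactly one at each of its first \<open>n - 1\<close> steps.\<close>
  define E where "E = {x \<in> space M. r x mod n = n - 1}"
  have [measurable]: "r \<in> measurable M (count_space UNIV)"
    unfolding r_def using A by measurable
  show E: "E \<in> sets M" unfolding E_def by measurable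
  have r_shift: "r ((T ^^ i) x) = r x - i" if x: "x \<in> space M" and "i \<le> r x" for x i
  proof -
    obtain j where "(T ^^ j) x \<in> A" using sweeping[OF x] by blast
    then have hit: "(T ^^ r x) x \<in> A" unfolding r_def by (rule LeastI)
    have least: "r x \<le> j" if "(T ^^ j) x \<in> A" for j
      unfolding r_def using that by (rule Least_le)
    show ?thesis
      unfolding r_def[of "(T ^^ i) x"]
    proof (rule Least_equality)
      show "(T ^^ (r x - i)) ((T ^^ i) x) \<in> A"
        using hit \<open>i \<le> r x\<close> by (metis comp_apply funpow_add le_add_diff_inverse2)
      show "r x - i \<le> j" if "(T ^^ j) ((T ^^ i) x) \<in> A" for j
        using least[of "j + i"] that by (simp add: funpow_add)
    qed
  qed
  show "((T ^^ m) -` E \<inter> space M) \<inter> E = {}" if m: "m \<in> {1..<n}" for m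
  proof -
    have False if x: "x \<in> E" and y: "(T ^^ m) x \<in> E" for x
    proof -
      have 1: "r x mod n = n - 1" "x \<in> space M" using x by (auto simp: E_def)
      have 2: "r ((T ^^ m) x) mod n = n - 1" using y by (auto simp: E_def)
      have "m \<le> r x mod n" using m 1 by auto
      then have "m \<le> r x" using mod_less_eq_dividend order_trans by blast
      then have "(r x - m) mod n = n - 1" using r_shift[OF 1(2)] 2 by simp
      then have "n dvd r x - (r x - m)"
        using 1 by (metis diff_le_self mod_eq_dvd_iff_nat)
      then have "n dvd m" using \<open>m \<le> r x\<close> by simp
      then show False using m by (auto dest: dvd_imp_le)
    qed
    then show ?thesis by blast
  qed
  define U where "U = (\<Union>j<n. (T ^^ j) -` E \<inter> space M)"
  \<comment> \<open>\<open>B\<close> collects the points that meet \<open>A\<close> before time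
    \<open>n\<close>; its measure is the only loss in the covering estimate.\<close>
  define B where "B = (\<Union>j<n. (T ^^ j) -` A \<inter> space M)"
  have U: "U \<in> sets M" unfolding U_def using E by measurable
  have B: "B \<in> sets M" unfolding B_def using A by measurable
  have "space M \<subseteq> U \<union> B"
  proof
    fix x assume x: "x \<in> space M"
    show "x \<in> U \<union> B"
    proof (cases "r x < n")
      case True
      obtain j where "(T ^^ j) x \<in> A" using sweeping[OF x] by blast
      then have "(T ^^ r x) x \<in> A" unfolding r_def by (rule LeastI)
      then show ?thesis using True x by (auto simp: B_def)
    next
      case False
      \<comment> \<open>After \<open>i\<close> steps the hitting time is congruent to -1 modulo
        \<open>n\<close>. Since \<open>i < n \<le> r x\<close>, the hit has not happened before time
        \<open>i\<close>, so \<open>r_shift\<close> applies.\<close>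
      define i where "i = (r x + 1) mod n"
      have i: "i < n" using n by (simp add: i_def)
      then have "i \<le> r x" using False by simp
      have "n dvd r x + 1 - i" by (simp add: i_def)
      then obtain q where q: "r x + 1 - i = n * q" ..
      then obtain q' where "q = Suc q'" using i False by (cases q) auto
      then have "r x - i = n * q' + (n - 1)" using q n \<open>i \<le> r x\<close> by simp
      then have "(r x - i) mod n = (n - 1) mod n" by (simp only: mod_mult_self4)
      then have "(r x - i) mod n = n - 1" using n by simp
      then have "(T ^^ i) x \<in> E"
        using r_shift[OF x \<open>i \<le> r x\<close>] x funpow_in_space by (simp add: E_def)
      then show ?thesis using x i by (auto simp: U_def)
    qed
  qed
  then have "1 \<le> measure M (U \<union> B)"
    using U B by (metis finite_measure_mono prob_space sets.Un)
  also have "\<dots> \<le> measure M U + measure M B"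
    using U B by (rule measure_Un_le)
  also have "measure M B \<le> (\<Sum>j<n. measure M ((T ^^ j) -` A \<inter> space M))"
    unfolding B_def using A by (intro finite_measure_subadditive_finite) auto
  also have "\<dots> = real n * measure M A"
    by (simp add: measure_vimage_funpow[OF A])
  finally show "measure M (\<Union>j<n. (T ^^ j) -` E \<inter> space M) \<ge> 1 - real n * measure M A"
    by (simp add: U_def)
qed

text \<open>The order enters only through \<open>F\<close>: its lower bound gives every orbit an
  infimum, and \<open>aperiodic\<close> turns weak minimality along an orbit into strict minimality
  almost everywhere.\<close>

lemma small_sweeping_set:
  fixes F :: "'a \<Rightarrow> real"
  assumes F [measurable]: "F \<in> borel_measurable M"
    and bdd: "\<And>x. x \<in> space M \<Longrightarrow> 0 \<le> F x"
    and aperiodic: "\<And>m. m \<ge> 1 \<Longrightarrow> AE x in M. F ((T ^^ m) x) \<noteq> F x"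
    and "\<delta> > 0"
  obtains A where "A \<in> sets M" "measure M A < \<delta>"
    and "\<And>x. x \<in> space M \<Longrightarrow> \<exists>j. (T ^^ j) x \<in> A"
proof -
  define A where "A k = {x \<in> space M. \<forall>i. F x < F ((T ^^ i) x) + 1 / real (Suc k)}" for k
  define D where "D = {x \<in> space M. \<forall>i. F x \<le> F ((T ^^ i) x)}"
  define V where "V m q = {x \<in> D. F x < q \<and> (T ^^ m) x \<in> D \<and> q < F ((T ^^ m) x)}" for m q
  have A: "A k \<in> sets M" for k unfolding A_def by measurable
  have D: "D \<in> sets M" unfolding D_def by measurable
  have V: "V m q \<in> sets M" for m q
  proof -
    have "V m q = D \<inter> {x \<in> space M. F x < q \<and> q < F ((T ^^ m) x)} \<inter> ((T ^^ m) -` D \<inter> space M)"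
      by (auto simp: V_def D_def)
    also have "\<dots> \<in> sets M" using D by measurable
    finally show ?thesis .
  qed
  have "V m q \<in> null_sets M" for m q
  proof (rule eventually_wandering_null[OF V, of _ _ m])
    fix x j assume x: "x \<in> V m q" and "m \<le> j"
    then have "(T ^^ j) x = (T ^^ (j - m)) ((T ^^ m) x)"
      by (metis comp_apply funpow_add le_add_diff_inverse2)
    then have "F ((T ^^ m) x) \<le> F ((T ^^ j) x)" using x by (simp add: V_def D_def)
    then show "(T ^^ j) x \<notin> V m q" using x by (auto simp: V_def)
  qed
  \<comment> \<open>Restricting \<open>q\<close> to the rationals leaves countably many null sets,
    so almost every point avoids all of them at once.\<close>
  then have "AE x in M. \<forall>m. \<forall>q\<in>\<rat>. x \<notin> V m q"
    by (auto simp: AE_all_countable AE_ball_countable[OF countable_rat] intro: AE_not_in)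
  moreover have "AE x in M. \<forall>m\<in>{1..}. F ((T ^^ m) x) \<noteq> F x"
    by (subst AE_ball_countable) (auto intro: aperiodic)
  ultimately have "AE x in M. (\<forall>m. \<forall>q\<in>\<rat>. x \<notin> V m q) \<and> (\<forall>m\<in>{1..}. F ((T ^^ m) x) \<noteq> F x)"
    by eventually_elim blast
  then obtain N where N: "N \<in> null_sets M"
    and good: "\<And>x m q. x \<in> space M - N \<Longrightarrow> q \<in> \<rat> \<Longrightarrow> x \<notin> V m q"
      "\<And>x m. x \<in> space M - N \<Longrightarrow> m \<ge> 1 \<Longrightarrow> F ((T ^^ m) x) \<noteq> F x"
    by (elim AE_E3) auto
  \<comment> \<open>No point of \<open>D - N\<close> returns to \<open>D\<close>: a return at time
    \<open>m\<close> would leave a gap between the two values of \<open>F\<close>, and a rational in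
    that gap would put the point into some \<open>V m q\<close>.\<close>
  have "D - N \<in> null_sets M"
  proof (rule eventually_wandering_null[of _ 1])
    show "D - N \<in> sets M" using D N by auto
    fix x and m :: nat assume x: "x \<in> D - N" and m: "1 \<le> m"
    have xs: "x \<in> space M - N" using x by (auto simp: D_def)
    have "F x \<le> F ((T ^^ m) x)" using x by (simp add: D_def)
    then have "F x < F ((T ^^ m) x)" using good(2)[OF xs m] by simp
    then obtain q where "q \<in> \<rat>" "F x < q" "q < F ((T ^^ m) x)" using Rats_dense_in_real by blast
    then show "(T ^^ m) x \<notin> D - N" using good(1)[OF xs, of q m] x by (auto simp: V_def)
  qed
  then have "D \<in> null_sets M"
    using null_sets_subset[OF null_sets.Un[OF _ N] D, of "D - N"] by auto
  have "(\<Inter>k. A k) = D"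
  proof (intro equalityI subsetI)
    fix x assume x: "x \<in> (\<Inter>k. A k)"
    have "F x \<le> F ((T ^^ i) x)" for i
    proof (rule ccontr)
      assume "\<not> ?thesis"
      then obtain k where "1 / real (Suc k) < F x - F ((T ^^ i) x)"
        using nat_approx_posE[of "F x - F ((T ^^ i) x)"] by auto
      moreover have "F x < F ((T ^^ i) x) + 1 / real (Suc k)"
        using x by (auto simp: A_def)
      ultimately show False by linarith
    qed
    then show "x \<in> D" using x by (auto simp: D_def A_def)
  next
    fix x assume x: "x \<in> D"
    have "F x < F ((T ^^ i) x) + 1 / real (Suc k)" for i k
    proof -
      have "F x \<le> F ((T ^^ i) x)" using x by (simp add: D_def)
      then show ?thesis by (rule le_less_trans) simp
    qed
    then show "x \<in> (\<Inter>k. A k)" using x by (simp add: A_def D_def)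
  qed
  moreover have "decseq A"
  proof (rule decseq_SucI, rule subsetI)
    fix k x assume x: "x \<in> A (Suc k)"
    have "1 / real (Suc (Suc k)) \<le> 1 / real (Suc k)" by (simp add: frac_le)
    then have "F x < F ((T ^^ i) x) + 1 / real (Suc k)" for i
      using x unfolding A_def by (smt (verit) mem_Collect_eq)
    then show "x \<in> A k" using x by (simp add: A_def)
  qed
  ultimately have "(\<lambda>k. measure M (A k)) \<longlonglongrightarrow> measure M D"
    using finite_Lim_measure_decseq[of A] A by auto
  then have "\<forall>\<^sub>F k in sequentially. measure M (A k) < \<delta>"
    using \<open>D \<in> null_sets M\<close> \<open>\<delta> > 0\<close> by (auto simp: null_sets_def measure_def intro: order_tendstoD)
  then obtain k where k: "measure M (A k) < \<delta>" by (auto simp: eventually_sequentially)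
  have "\<exists>j. (T ^^ j) x \<in> A k" if x: "x \<in> space M" for x
  proof -
    define I where "I = (INF i. F ((T ^^ i) x))"
    have bdd: "bdd_below (range (\<lambda>i. F ((T ^^ i) x)))"
      using bdd funpow_in_space[OF x] by (intro bdd_belowI[of _ 0]) auto
    have "I < I + 1 / real (Suc k)" by simp
    then obtain j where j: "F ((T ^^ j) x) < I + 1 / real (Suc k)"
      unfolding I_def using cINF_less_iff[OF _ bdd] by blast
    have "F ((T ^^ j) x) < F ((T ^^ i) ((T ^^ j) x)) + 1 / real (Suc k)" for i
    proof -
      have "I \<le> F ((T ^^ (i + j)) x)" unfolding I_def by (rule cINF_lower[OF bdd]) simp
      then show ?thesis using j by (simp add: funpow_add)
    qed
    then show ?thesis using funpow_in_space[OF x] by (auto simp: A_def)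
  qed
  then show ?thesis using that A k by blast
qed

end

section \<open>The distribution function of the order\<close>

context shuffleable_system
begin

lemma order_interval_measurable: "order_interval X J \<Longrightarrow> J \<in> sets M"
  by (simp add: sets_eq interval_algebra_def sigma_sets.Basic)

lemma singleton_measure_zero:
  assumes "x \<in> X"
  shows "measure M {x} = 0"
proof (rule ccontr)
  assume "measure M {x} \<noteq> 0"
  moreover have "{x} \<in> sets M"
    using assms by (intro order_interval_measurable) (auto simp: order_interval_def)
  ultimately obtain B where "B \<subseteq> {x}" "0 < measure M B" "measure M B < measure M {x}"
    using non_atomic unfolding non_atomic_def by (metis zero_less_measure_iff)
  then show False by (metis less_irrefl measure_empty subset_singletonD)
qed

text \<open>It carries the order of \<open>X\<close> over to the reals, where infima and a countable
  dense set are available.\<close>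

definition cdf_order :: "'a \<Rightarrow> real" where
  "cdf_order x = measure M {y \<in> X. y \<le> x}"

lemma atMost_measurable: "{y \<in> X. y \<le> x} \<in> sets M"
  by (rule order_interval_measurable) (auto simp: order_interval_def)

lemma cdf_order_mono: "x \<le> y \<Longrightarrow> cdf_order x \<le> cdf_order y"
  unfolding cdf_order_def by (intro finite_measure_mono atMost_measurable) auto

text \<open>By monotonicity the sublevel sets are initial segments of \<open>X\<close>, hence
  intervals.\<close>

lemma cdf_order_measurable: "cdf_order \<in> borel_measurable M"
proof (subst borel_measurable_iff_le, intro allI order_interval_measurable)
  fix a
  show "order_interval X {w \<in> space M. cdf_order w \<le> a}"
    unfolding order_interval_def space_eq
  proof safe
    fix b c :: 'a assume "cdf_order c \<le> a" "b < c"
    then show "cdf_order b \<le> a" using cdf_order_mono[OF less_imp_le, of b c] by linarith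
  qed
qed

text \<open>The increment of \<open>cdf_order\<close> is the mass of the half-open interval, and the
  missing left endpoint is null. Hence nigh aperiodicity makes the points with
  \<open>cdf_order ((T ^^ m) x) = cdf_order x\<close> negligible.\<close>

lemma closed_between_null:
  assumes "x \<in> X" "y \<in> X" "cdf_order x = cdf_order y"
  shows "measure M (closed_between X x y) = 0"
  using assms
proof (induction x y rule: linorder_wlog)
  case (le x y)
  have J: "{z \<in> X. x < z \<and> z \<le> y} \<in> sets M" and s: "{x} \<in> sets M"
    using le by (auto intro!: order_interval_measurable simp: order_interval_def)
  have split: "{z \<in> X. x < z \<and> z \<le> y} = {z \<in> X. z \<le> y} - {z \<in> X. z \<le> x}" by auto
  have "{z \<in> X. z \<le> x} \<subseteq> {z \<in> X. z \<le> y}" using le by auto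
  then have "measure M {z \<in> X. x < z \<and> z \<le> y} = cdf_order y - cdf_order x"
    unfolding cdf_order_def split
    by (rule finite_measure_Diff[OF atMost_measurable atMost_measurable])
  then have "measure M {z \<in> X. x < z \<and> z \<le> y} = 0" using le by simp
  moreover have "closed_between X x y = {x} \<union> {z \<in> X. x < z \<and> z \<le> y}"
    using le by (auto simp: closed_between_def)
  ultimately show ?case
    using measure_Un_le[OF s J] singleton_measure_zero[of x] le
    by (simp add: measure_le_0_iff)
next
  case (sym x y)
  then show ?case by (simp add: closed_between_def min.commute max.commute)
qed

end

section \<open>Chains in a nigh aperiodic system\<close>

sublocale shuffleable_system \<subseteq> measure_preserving_system M T
  by unfold_locales (fact measurable_T measure_preserving)+

theorem theorem9:
  fixes X :: "'a::linorder set" and M :: "'a measure" and T :: "'a \<Rightarrow> 'a"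
    and n :: nat and \<epsilon> :: real
  assumes "shuffleable_system X M T"
    and "nigh_aperiodic M T"
    and "n \<ge> 1"
    and "\<epsilon> > 0"
  shows "\<exists>E. induces_chain M T n E \<and>
           measure M (\<Union>j<n. (T ^^ j) -` E \<inter> space M) > 1 - \<epsilon>"
proof -
  interpret shuffleable_system X M T by fact
  have aperiodic: "AE x in M. cdf_order ((T ^^ m) x) \<noteq> cdf_order x" if "m \<ge> 1" for m
  proof (rule AE_I')
    show "{x \<in> space M. measure M (closed_between (space M) x ((T ^^ m) x)) = 0} \<in> null_sets M"
      using assms(2) that by (simp add: nigh_aperiodic_def)
    show "{x \<in> space M. \<not> cdf_order ((T ^^ m) x) \<noteq> cdf_order x}
        \<subseteq> {x \<in> space M. measure M (closed_between (space M) x ((T ^^ m) x)) = 0}"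
      using closed_between_null funpow_in_space by (auto simp: space_eq)
  qed
  \<comment> \<open>Division by \<open>n\<close> offsets the factor \<open>n\<close> in the covering
    bound. The cap at 1 makes the union have positive measure even for large
    \<open>\<epsilon>\<close>, which forces \<open>measure M E > 0\<close>.\<close>
  define \<delta> where "\<delta> = min \<epsilon> 1 / real n"
  have "\<delta> > 0" using assms by (simp add: \<delta>_def)
  obtain A where A: "A \<in> sets M" "measure M A < \<delta>"
    and sweeping: "\<And>x. x \<in> space M \<Longrightarrow> \<exists>j. (T ^^ j) x \<in> A"
    using small_sweeping_set[OF cdf_order_measurable _ aperiodic \<open>\<delta> > 0\<close>]
    by (auto simp: cdf_order_def)
  obtain E where E: "E \<in> sets M"
    and chain: "\<And>m. m \<in> {1..<n} \<Longrightarrow> ((T ^^ m) -` E \<inter> space M) \<inter> E = {}"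
    and cover: "measure M (\<Union>j<n. (T ^^ j) -` E \<inter> space M) \<ge> 1 - real n * measure M A"
    using tower_over_sweeping_set[OF A(1) sweeping \<open>n \<ge> 1\<close>] by blast
  have "real n * measure M A < min \<epsilon> 1"
    using A(2) \<open>n \<ge> 1\<close> by (simp add: \<delta>_def field_simps)
  then have big: "measure M (\<Union>j<n. (T ^^ j) -` E \<inter> space M) > 1 - min \<epsilon> 1"
    using cover by linarith
  have "measure M (\<Union>j<n. (T ^^ j) -` E \<inter> space M)
      \<le> (\<Sum>j<n. measure M ((T ^^ j) -` E \<inter> space M))"
    using E by (intro finite_measure_subadditive_finite) auto
  also have "\<dots> = real n * measure M E"
    by (simp add: measure_vimage_funpow[OF E])
  finally have "0 < real n * measure M E" using big by linarith
  then have "measure M E > 0" by (simp add: zero_less_mult_iff)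
  then have "induces_chain M T n E"
    using E chain by (simp add: induces_chain_def)
  then show ?thesis using big by (intro exI[of _ E]) simp
qed

end
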